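(* Let $N\geq 1$ and let $\mathfrak{g}$ be the complex Lie algebra of derivations of $\mathcal{K}_N$ spanned by $\tilde{\partial}_1,\ldots,\tilde{\partial}_N$. Let $\lambda_1,\ldots,\lambda_N\in\mathbb{R}$ and let $h$ be the left hermitian form on $\Omega^1_{\mathfrak{g}}$ determined by $h(d\alpha_i,d\alpha_j)=\delta_{ij}\lambda_i\alpha_i$ (no summation) for $i,j=1,\ldots,N$. Then the $\mathbb{C}$-bilinear map $\nabla:\mathfrak{g}\times\Omega^1_{\mathfrak{g}}\to\Omega^1_{\mathfrak{g}}$ determined by $$\nabla_{\tilde{\partial}_i}d\alpha_j=\tfrac12\delta_{ij}\,d\alpha_i\qquad(i,j=1,\ldots,N,\ \text{no summation})$$ is a $\ast$-bimodule Levi-Civita connection on $\Omega^1_{\mathfrak{g}}$ with respect to $h$; that is, $\nabla$ is a torsion free $\ast$-bimodule connection compatible with $h$.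
   Context: $\mathcal{K}_N$ is the unital associative $\mathbb{C}$-algebra generated by $e,\alpha_1,\ldots,\alpha_N$ subject to $e^2=e$, $e\alpha_k=\alpha_k$, $\alpha_k e=0$, $\alpha_j\alpha_k=0$ for all $j,k$; the elements $1,e,\alpha_1,\ldots,\alpha_N$ form a vector space basis. It is a $\ast$-algebra (conjugate-linear, anti-multiplicative involution) with $e^\ast=1-e$, $\alpha_i^\ast=\alpha_i$. For a derivation $\partial$, $\partial^\ast(a)=(\partial(a^\ast))^\ast$. $\tilde\partial_i$ is the derivation of $\mathcal{K}_N$ with $\tilde\partial_i(e)=i\alpha_i$ (where the coefficient $i$ is the imaginary unit) and $\tilde\partial_i(\alpha_k)=\delta_{ik}\alpha_i$. One has $\tilde\partial_i^\ast=\tilde\partial_i$ and $[\tilde\partial_i,\tilde\partial_j]=0$. $\Omega^1_{\mathfrak{g}}$ is the $\mathcal{K}_N$-bimodule of all finite sums of maps $a\,db:\mathfrak{g}\to\mathcal{K}_N$, $(a\,db)(\partial)=a\,\partial(b)$, with $(a\omega)(\partial)=a\,\omega(\partial)$, $(\omega a)(\partial)=\omega(\partial)a$ and involution $\omega^\ast(\partial)=\omega(\partial^\ast)^\ast$. For this $\mathfrak{g}$ the forms $d\alpha_1,\ldots,d\alpha_N$ are a complex vector space basis of $\Omega^1_{\mathfrak{g}}$, and $h$ is given on general elements by $h(\omega^id\alpha_i,\eta^jd\alpha_j)=\omega^ih(d\alpha_i,d\alpha_j)\bar\eta^j$ for $\omega^i,\eta^j\in\mathbb{C}$ (repeated indices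 summed). A left connection is a map $\nabla:\mathfrak{g}\times\Omega^1_{\mathfrak{g}}\to\Omega^1_{\mathfrak{g}}$, additive in both arguments, $\mathbb{C}$-linear in $\partial$, with $\nabla_\partial(a\omega)=a\nabla_\partial\omega+\partial(a)\omega$; a right connection satisfies instead $\nabla_\partial(\omega a)=(\nabla_\partial\omega)a+\omega\,\partial(a)$; a bimodule connection is both. A $\ast$-bimodule connection is a left connection with $(\nabla_\partial\omega)^\ast=\nabla_{\partial^\ast}\omega^\ast$ (it is then automatically a bimodule connection). The connection is torsion free if $(\nabla_\partial\omega)(\partial')-(\nabla_{\partial'}\omega)(\partial)-d\omega(\partial,\partial')=0$ for all $\omega,\partial,\partial'$, where $d\omega(\partial,\partial')=\partial(\omega(\partial'))-\partial'(\omega(\partial))-\omega([\partial,\partial'])$. A left hermitian form on a left module $M$ is a map $h:M\times M\to\mathcal{K}_N$, additive in its arguments, with $h(am_1,m_2)=ah(m_1,m_2)$ and $h(m_1,m_2)^\ast=h(m_2,m_1)$. $\nabla$ is compatible with $h$ if $\partial\big(h(\omega,\eta)\big)=h(\nabla_\partial\omega,\eta)+h(\omega,\nabla_{\partial^\ast}\eta)$ for all $\partial\in\mathfrak{g}$, $\omega,\eta\in\Omega^1_{\mathfrak{g}}$. *)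

theory Defs
  imports Complex_Main "HOL-Library.Poly_Mapping"
begin

section \<open>Complex vector spaces and unital complex algebras\<close>

class complex_vector = ab_group_add +
  fixes cscale :: "complex \<Rightarrow> 'a \<Rightarrow> 'a"  (infixr "*\<^sub>C" 75)
  assumes cscale_add_right: "c *\<^sub>C (x + y) = c *\<^sub>C x + c *\<^sub>C y"
    and cscale_add_left: "(c + d) *\<^sub>C x = c *\<^sub>C x + d *\<^sub>C x"
    and cscale_cscale [simp]: "c *\<^sub>C d *\<^sub>C x = (c * d) *\<^sub>C x"
    and cscale_one [simp]: "1 *\<^sub>C x = x"
begin

lemma cscale_zero_right [simp]: "c *\<^sub>C 0 = 0"
  using cscale_add_right[of c 0 0] by simp

lemma cscale_zero_left [simp]: "0 *\<^sub>C x = 0"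
  using cscale_add_left[of 0 0 x] by simp

lemma cscale_minus_left: "(- c) *\<^sub>C x = - (c *\<^sub>C x)"
  by (rule minus_unique[symmetric]) (simp flip: cscale_add_left)

lemma cscale_minus_right: "c *\<^sub>C (- x) = - (c *\<^sub>C x)"
  by (rule minus_unique[symmetric]) (simp flip: cscale_add_right)

lemma cscale_diff_right: "c *\<^sub>C (x - y) = c *\<^sub>C x - c *\<^sub>C y"
  using cscale_add_right[of c x "- y"] by (simp add: cscale_minus_right)

lemma cscale_sum_right: "c *\<^sub>C sum f A = (\<Sum>i\<in>A. c *\<^sub>C f i)"
  by (induction A rule: infinite_finite_induct) (simp_all add: cscale_add_right)

end

class complex_algebra_1 = complex_vector + ring_1 +
  assumes cscale_mult_left: "(c *\<^sub>C x) * y = c *\<^sub>C (x * y)"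
    and cscale_mult_right: "x * (c *\<^sub>C y) = c *\<^sub>C (x * y)"

section \<open>The algebra given by generators and relations\<close>

text \<open>
  The index set \<open>{1,\<dots>,N}\<close> is rendered as a finite type \<^typ>\<open>'n\<close>; types are nonempty, so
  \<open>N \<ge> 1\<close> holds automatically.  The free algebra on the generators is the algebra of finitely
  supported complex functions on words, with convolution product.
\<close>

datatype 'n gen = Gen_e | Gen_alpha 'n

datatype 'a free_word = Free_Word (letters: "'a list")

instantiation free_word :: (type) monoid_add
begin

definition zero_free_word :: "'a free_word" where
  "0 = Free_Word []"

definition plus_free_word :: "'a free_word \<Rightarrow> 'a free_word \<Rightarrow> 'a free_word" where
  "v + w = Free_Word (letters v @ letters w)"

instance
  by standard (simp_all add: zero_free_word_def plus_free_word_def)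

end

type_synonym 'n free_alg = "'n gen free_word \<Rightarrow>\<^sub>0 complex"

definition free_e :: "'n free_alg" where
  "free_e = Poly_Mapping.single (Free_Word [Gen_e]) 1"

definition free_alpha :: "'n \<Rightarrow> 'n free_alg" where
  "free_alpha k = Poly_Mapping.single (Free_Word [Gen_alpha k]) 1"

definition relators :: "'n free_alg set" where
  "relators = {free_e * free_e - free_e}
     \<union> {free_e * free_alpha k - free_alpha k | k. True}
     \<union> {free_alpha k * free_e | k. True}
     \<union> {free_alpha j * free_alpha k | j k. True}"

inductive_set relation_ideal :: "'n free_alg set" where
  zero: "0 \<in> relation_ideal"
| gen: "r \<in> relators \<Longrightarrow> p * r * q \<in> relation_ideal"
| add: "x \<in> relation_ideal \<Longrightarrow> y \<in> relation_ideal \<Longrightarrow> x + y \<in> relation_ideal"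

lemma relation_ideal_mult_left: "x \<in> relation_ideal \<Longrightarrow> a * x \<in> relation_ideal"
proof (induction rule: relation_ideal.induct)
  case (gen r p q)
  then show ?case using relation_ideal.gen[of r "a * p" q] by (simp add: mult.assoc)
qed (simp_all add: relation_ideal.intros distrib_left)

lemma relation_ideal_mult_right: "x \<in> relation_ideal \<Longrightarrow> x * a \<in> relation_ideal"
proof (induction rule: relation_ideal.induct)
  case (gen r p q)
  then show ?case using relation_ideal.gen[of r p "q * a"] by (simp add: mult.assoc)
qed (simp_all add: relation_ideal.intros distrib_right)

lemma relation_ideal_minus: "x \<in> relation_ideal \<Longrightarrow> - x \<in> relation_ideal"
  using relation_ideal_mult_left[of x "- 1"] by simp

lemma relation_ideal_diff:
  "x \<in> relation_ideal \<Longrightarrow> y \<in> relation_ideal \<Longrightarrow> x - y \<in> relation_ideal"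
  using relation_ideal.add[of x "- y"] relation_ideal_minus[of y] by simp

lemma relator_in_ideal: "r \<in> relators \<Longrightarrow> r \<in> relation_ideal"
  using relation_ideal.gen[of r 1 1] by simp

lemma free_alg_induct [case_names single add]:
  assumes "\<And>w c. P (Poly_Mapping.single w c)"
    and "\<And>p q. P p \<Longrightarrow> P q \<Longrightarrow> P (p + q)"
  shows "P (p :: 'a \<Rightarrow>\<^sub>0 complex)"
proof (induction p rule: update_induct)
  case const
  show ?case using assms(1)[of undefined 0] by simp
next
  case (update f a b)
  have "Poly_Mapping.update a b f = f + Poly_Mapping.single a b"
    by (rule poly_mapping_eqI)
      (use update in \<open>auto simp: lookup_update lookup_add lookup_single when_def in_keys_iff\<close>)
  then show ?case using assms update by simp
qed

lemma const_central:
  "Poly_Mapping.single 0 c * p = (p :: 'n free_alg) * Poly_Mapping.single 0 c"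
  by (induction p rule: free_alg_induct) (simp_all add: mult_single distrib_left distrib_right mult.commute)

definition word_eval :: "('a \<Rightarrow> 'b::complex_algebra_1) \<Rightarrow> 'a free_word \<Rightarrow> 'b" where
  "word_eval g w = prod_list (map g (letters w))"

definition free_eval :: "('a \<Rightarrow> 'b::complex_algebra_1) \<Rightarrow> ('a free_word \<Rightarrow>\<^sub>0 complex) \<Rightarrow> 'b" where
  "free_eval g p = (\<Sum>w\<in>Poly_Mapping.keys p. Poly_Mapping.lookup p w *\<^sub>C word_eval g w)"

lemma free_eval_superset:
  assumes "finite S" "Poly_Mapping.keys p \<subseteq> S"
  shows "free_eval g p = (\<Sum>w\<in>S. Poly_Mapping.lookup p w *\<^sub>C word_eval g w)"
  unfolding free_eval_def
  by (rule sum.mono_neutral_left) (use assms in \<open>auto simp: in_keys_iff\<close>)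

lemma free_eval_add [simp]: "free_eval g (p + q) = free_eval g p + free_eval g q"
proof -
  let ?S = "Poly_Mapping.keys p \<union> Poly_Mapping.keys q"
  have "Poly_Mapping.keys (p + q) \<subseteq> ?S" by (rule keys_add)
  then show ?thesis
    by (simp add: free_eval_superset[of ?S] lookup_add cscale_add_left sum.distrib)
qed

lemma free_eval_zero [simp]: "free_eval g 0 = 0"
  by (simp add: free_eval_def)

lemma free_eval_minus [simp]: "free_eval g (- p) = - free_eval g p"
  using free_eval_add[of g p "- p"] by (simp add: eq_neg_iff_add_eq_0 add.commute del: free_eval_add)

lemma free_eval_diff [simp]: "free_eval g (p - q) = free_eval g p - free_eval g q"
  using free_eval_add[of g p "- q"] by (simp del: free_eval_add)

lemma free_eval_single [simp]:
  "free_eval g (Poly_Mapping.single w c) = c *\<^sub>C word_eval g w"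
  by (simp add: free_eval_def)

lemma word_eval_zero [simp]: "word_eval g 0 = 1"
  by (simp add: word_eval_def zero_free_word_def)

lemma word_eval_plus [simp]: "word_eval g (v + w) = word_eval g v * word_eval g w"
  by (simp add: word_eval_def plus_free_word_def)

lemma free_eval_one [simp]: "free_eval g 1 = 1"
  using free_eval_single[of g 0 1] by (simp del: free_eval_single)

lemma free_eval_mult [simp]: "free_eval g (p * q) = free_eval g p * free_eval g q"
proof (induction p rule: free_alg_induct)
  case (single v c)
  show ?case
    by (induction q rule: free_alg_induct)
      (simp_all add: mult_single distrib_left cscale_add_right cscale_mult_left cscale_mult_right
        mult.commute)
qed (simp add: distrib_right)

lemma free_eval_ideal:
  assumes "\<And>r. r \<in> relators \<Longrightarrow> free_eval g r = 0" "p \<in> relation_ideal"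
  shows "free_eval g p = 0"
  using assms(2) by (induction rule: relation_ideal.induct) (simp_all add: assms(1))

text \<open>
  The multiplication table in the coordinates of \<open>1, e, \<alpha>\<^sub>1, \<dots>, \<alpha>\<^sub>N\<close>.  It is used only to prove
  facts about the quotient algebra defined below, in particular that these elements form a basis.
\<close>

datatype 'n coords = Coords (co_1: complex) (co_e: complex) (co_a: "'n \<Rightarrow> complex")

instantiation coords :: (type) complex_algebra_1
begin

definition "0 = Coords 0 0 (\<lambda>_. 0)"
definition "1 = Coords 1 0 (\<lambda>_. 0)"
definition "x + y = Coords (co_1 x + co_1 y) (co_e x + co_e y) (\<lambda>k. co_a x k + co_a y k)"
definition "x - y = Coords (co_1 x - co_1 y) (co_e x - co_e y) (\<lambda>k. co_a x k - co_a y k)"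
definition "- x = Coords (- co_1 x) (- co_e x) (\<lambda>k. - co_a x k)"
definition "c *\<^sub>C x = Coords (c * co_1 x) (c * co_e x) (\<lambda>k. c * co_a x k)"
definition "x * y = Coords (co_1 x * co_1 y)
   (co_1 x * co_e y + co_e x * co_1 y + co_e x * co_e y)
   (\<lambda>k. (co_1 x + co_e x) * co_a y k + co_a x k * co_1 y)"

lemmas coords_defs = zero_coords_def one_coords_def plus_coords_def minus_coords_def
  uminus_coords_def cscale_coords_def times_coords_def

instance
  by standard (auto simp: coords_defs algebra_simps)

end

fun coords_gen :: "'n gen \<Rightarrow> 'n coords" where
  "coords_gen Gen_e = Coords 0 1 (\<lambda>_. 0)"
| "coords_gen (Gen_alpha i) = Coords 0 0 (\<lambda>k. if k = i then 1 else 0)"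

lemma word_eval_single [simp]: "word_eval g (Free_Word [x]) = g x"
  by (simp add: word_eval_def)

lemma coords_eval_relator: "r \<in> relators \<Longrightarrow> free_eval coords_gen r = 0"
  by (auto simp: relators_def free_e_def free_alpha_def) (auto simp: coords_defs fun_eq_iff)

lemma coords_eval_ideal: "p \<in> relation_ideal \<Longrightarrow> free_eval coords_gen p = 0"
  by (rule free_eval_ideal) (simp_all add: coords_eval_relator)

quotient_type 'n kalg = "'n free_alg" / "\<lambda>p q. p - q \<in> relation_ideal"
proof (rule equivpI)
  show "reflp (\<lambda>p q :: 'n free_alg. p - q \<in> relation_ideal)"
    by (auto intro!: reflpI relation_ideal.zero)
  show "symp (\<lambda>p q :: 'n free_alg. p - q \<in> relation_ideal)"
    by (auto intro!: sympI dest: relation_ideal_minus)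
  show "transp (\<lambda>p q :: 'n free_alg. p - q \<in> relation_ideal)"
    by (auto intro!: transpI dest: relation_ideal.add)
qed

instantiation kalg :: (type) complex_algebra_1
begin

lift_definition zero_kalg :: "'n kalg" is 0 .
lift_definition one_kalg :: "'n kalg" is 1 .
lift_definition plus_kalg :: "'n kalg \<Rightarrow> 'n kalg \<Rightarrow> 'n kalg" is "(+)"
  by (metis add_diff_add relation_ideal.add)
lift_definition uminus_kalg :: "'n kalg \<Rightarrow> 'n kalg" is uminus
  by (metis minus_diff_minus relation_ideal_minus)
lift_definition minus_kalg :: "'n kalg \<Rightarrow> 'n kalg \<Rightarrow> 'n kalg" is "(-)"
proof -
  fix p p' q q' :: "'n free_alg"
  assume "p - p' \<in> relation_ideal" "q - q' \<in> relation_ideal"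
  then have "(p - p') - (q - q') \<in> relation_ideal" by (rule relation_ideal_diff)
  then show "p - q - (p' - q') \<in> relation_ideal" by (simp add: algebra_simps)
qed
lift_definition times_kalg :: "'n kalg \<Rightarrow> 'n kalg \<Rightarrow> 'n kalg" is "(*)"
proof -
  fix p p' q q' :: "'n free_alg"
  assume "p - p' \<in> relation_ideal" "q - q' \<in> relation_ideal"
  then have "p * (q - q') + (p - p') * q' \<in> relation_ideal"
    by (simp add: relation_ideal.add relation_ideal_mult_left relation_ideal_mult_right)
  then show "p * q - p' * q' \<in> relation_ideal"
    by (simp add: algebra_simps)
qed
lift_definition cscale_kalg :: "complex \<Rightarrow> 'n kalg \<Rightarrow> 'n kalg"
  is "\<lambda>c p. Poly_Mapping.single 0 c * p"
  by (simp add: relation_ideal_mult_left flip: right_diff_distrib)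

lemma kalg_eqI: "p = q \<Longrightarrow> p - q \<in> relation_ideal"
  by (simp add: relation_ideal.zero)

instance
proof
  fix x y z :: "'n kalg" and c d :: complex
  show "x + y + z = x + (y + z)" by transfer (rule kalg_eqI, simp add: algebra_simps)
  show "x + y = y + x" by transfer (rule kalg_eqI, simp add: algebra_simps)
  show "0 + x = x" by transfer (rule kalg_eqI, simp add: algebra_simps)
  show "- x + x = 0" by transfer (rule kalg_eqI, simp add: algebra_simps)
  show "x - y = x + - y" by transfer (rule kalg_eqI, simp add: algebra_simps)
  show "x * y * z = x * (y * z)" by transfer (rule kalg_eqI, simp add: algebra_simps)
  show "1 * x = x" by transfer (rule kalg_eqI, simp)
  show "x * 1 = x" by transfer (rule kalg_eqI, simp)
  show "(x + y) * z = x * z + y * z" by transfer (rule kalg_eqI, simp add: algebra_simps)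
  show "x * (y + z) = x * y + x * z" by transfer (rule kalg_eqI, simp add: algebra_simps)
  show "(0 :: 'n kalg) \<noteq> 1"
  proof (transfer, rule notI)
    assume "(0 :: 'n free_alg) - 1 \<in> relation_ideal"
    then have "free_eval coords_gen ((0 :: 'n free_alg) - 1) = 0" by (rule coords_eval_ideal)
    then show False by simp
  qed
  show "c *\<^sub>C (x + y) = c *\<^sub>C x + c *\<^sub>C y"
    by transfer (rule kalg_eqI, simp add: algebra_simps)
  show "(c + d) *\<^sub>C x = c *\<^sub>C x + d *\<^sub>C x"
    by transfer (rule kalg_eqI, simp add: algebra_simps single_add)
  show "c *\<^sub>C d *\<^sub>C x = (c * d) *\<^sub>C x"
    by transfer (rule kalg_eqI, simp add: mult_single flip: mult.assoc)
  show "1 *\<^sub>C x = x"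
    by transfer (rule kalg_eqI, simp)
  show "(c *\<^sub>C x) * y = c *\<^sub>C (x * y)"
    by transfer (rule kalg_eqI, simp add: mult.assoc)
  show "x * (c *\<^sub>C y) = c *\<^sub>C (x * y)"
    by transfer (rule kalg_eqI, metis const_central mult.assoc)
qed

end

lift_definition K_e :: "'n kalg" is free_e .
lift_definition K_alpha :: "'n \<Rightarrow> 'n kalg" is free_alpha .

lemma K_relations [simp]:
  "K_e * K_e = K_e" "K_e * K_alpha k = K_alpha k" "K_alpha k * K_e = 0" "K_alpha j * K_alpha k = 0"
  by (transfer, rule relator_in_ideal, auto simp: relators_def)+


lift_definition to_coords :: "'n kalg \<Rightarrow> 'n coords" is "free_eval coords_gen"
  by (metis coords_eval_ideal eq_iff_diff_eq_0 free_eval_diff)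

lemma to_coords_simps [simp]:
  "to_coords 0 = 0" "to_coords 1 = 1"
  "to_coords (x + y) = to_coords x + to_coords y"
  "to_coords (- x) = - to_coords x"
  "to_coords (x - y) = to_coords x - to_coords y"
  "to_coords (x * y) = to_coords x * to_coords y"
  "to_coords (c *\<^sub>C x) = c *\<^sub>C to_coords x"
  "to_coords K_e = Coords 0 1 (\<lambda>_. 0)"
  "to_coords (K_alpha i) = Coords 0 0 (\<lambda>k. if k = i then 1 else 0)"
  by (transfer; simp add: free_e_def free_alpha_def cscale_mult_left)+

lemma to_coords_sum [simp]: "to_coords (sum f A) = (\<Sum>i\<in>A. to_coords (f i))"
  by (induction A rule: infinite_finite_induct) simp_all

lemma co_simps [simp]:
  "co_1 0 = 0" "co_e 0 = 0" "co_a 0 k = 0"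
  "co_1 1 = 1" "co_e 1 = 0" "co_a 1 k = 0"
  "co_1 (x + y) = co_1 x + co_1 y" "co_e (x + y) = co_e x + co_e y"
  "co_a (x + y) k = co_a x k + co_a y k"
  "co_1 (- x) = - co_1 x" "co_e (- x) = - co_e x" "co_a (- x) k = - co_a x k"
  "co_1 (x - y) = co_1 x - co_1 y" "co_e (x - y) = co_e x - co_e y"
  "co_a (x - y) k = co_a x k - co_a y k"
  "co_1 (c *\<^sub>C x) = c * co_1 x" "co_e (c *\<^sub>C x) = c * co_e x"
  "co_a (c *\<^sub>C x) k = c * co_a x k"
  "co_1 (x * y) = co_1 x * co_1 y"
  "co_e (x * y) = co_1 x * co_e y + co_e x * co_1 y + co_e x * co_e y"
  "co_a (x * y) k = (co_1 x + co_e x) * co_a y k + co_a x k * co_1 y"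
  by (simp_all add: coords_defs)

lemma co_sum [simp]:
  "co_1 (sum f A) = (\<Sum>i\<in>A. co_1 (f i))" "co_e (sum f A) = (\<Sum>i\<in>A. co_e (f i))"
  "co_a (sum f A) k = (\<Sum>i\<in>A. co_a (f i) k)"
  by (induction A rule: infinite_finite_induct) simp_all

lemma coords_eqI: "co_1 x = co_1 y \<Longrightarrow> co_e x = co_e y \<Longrightarrow> (\<And>k. co_a x k = co_a y k) \<Longrightarrow> x = y"
  by (cases x; cases y) auto

fun kalg_gen :: "'n gen \<Rightarrow> 'n kalg" where
  "kalg_gen Gen_e = K_e"
| "kalg_gen (Gen_alpha i) = K_alpha i"

lemma abs_kalg_single_letter: "abs_kalg (Poly_Mapping.single (Free_Word [g]) 1) = kalg_gen g"
  by (cases g) (simp_all add: K_e.abs_eq K_alpha.abs_eq free_e_def free_alpha_def)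

lemma abs_kalg_word: "abs_kalg (Poly_Mapping.single (Free_Word gs) 1) = word_eval kalg_gen (Free_Word gs)"
proof (induction gs)
  case Nil
  have "Poly_Mapping.single (Free_Word []) 1 = (1 :: 'a free_alg)"
    by (simp flip: zero_free_word_def)
  then show ?case
    by (simp add: word_eval_def one_kalg_def)
next
  case (Cons g gs)
  have "Poly_Mapping.single (Free_Word (g # gs)) 1
      = Poly_Mapping.single (Free_Word [g]) 1 * Poly_Mapping.single (Free_Word gs) (1 :: complex)"
    by (simp add: mult_single plus_free_word_def)
  then show ?case
    using Cons by (simp add: word_eval_def abs_kalg_single_letter flip: times_kalg.abs_eq)
qed

lemma abs_kalg_eq_eval: "abs_kalg p = free_eval kalg_gen p"
proof (induction p rule: free_alg_induct)
  case (single w c)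
  have "Poly_Mapping.single w c = Poly_Mapping.single 0 c * Poly_Mapping.single w 1"
    by (simp add: mult_single)
  then have "abs_kalg (Poly_Mapping.single w c) = c *\<^sub>C abs_kalg (Poly_Mapping.single w 1)"
    by (simp only: cscale_kalg.abs_eq)
  also have "\<dots> = c *\<^sub>C word_eval kalg_gen w"
    by (cases w) (simp only: abs_kalg_word)
  finally show ?case by simp
qed (simp flip: plus_kalg.abs_eq)

lemma kalg_induct [case_names e alpha one add mult scale]:
  assumes "P K_e" "\<And>i. P (K_alpha i)" "P 1" "\<And>x y. P x \<Longrightarrow> P y \<Longrightarrow> P (x + y)"
    "\<And>x y. P x \<Longrightarrow> P y \<Longrightarrow> P (x * y)" "\<And>c x. P x \<Longrightarrow> P (c *\<^sub>C x)"
  shows "P (x :: 'n kalg)"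
proof -
  have gen: "P (kalg_gen g)" for g using assms by (cases g) auto
  have "P (prod_list (map kalg_gen gs))" for gs
    by (induction gs) (auto intro: gen assms)
  then have "P (free_eval kalg_gen p)" for p
    by (induction p rule: free_alg_induct) (auto simp: word_eval_def intro: assms)
  then show ?thesis
    by (metis abs_kalg_eq_eval kalg.abs_induct)
qed

definition of_coords :: "'n::finite coords \<Rightarrow> 'n kalg" where
  "of_coords x = co_1 x *\<^sub>C 1 + co_e x *\<^sub>C K_e + (\<Sum>k\<in>UNIV. co_a x k *\<^sub>C K_alpha k)"

lemma of_coords_add: "of_coords (x + y) = of_coords x + of_coords y"
  by (simp add: of_coords_def cscale_add_left sum.distrib)

lemma of_coords_scale: "of_coords (c *\<^sub>C x) = c *\<^sub>C of_coords x"
  by (simp add: of_coords_def cscale_add_right cscale_sum_right)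

lemma of_coords_mult: "of_coords (x * y) = of_coords x * of_coords y"
proof -
  define s where "s = (\<lambda>x. \<Sum>k\<in>UNIV. co_a x k *\<^sub>C (K_alpha k :: 'a kalg))"
  have es: "K_e * s y = s y" and se: "s x * K_e = 0" and ss: "s x * s y = 0"
    by (simp_all add: s_def sum_distrib_left sum_distrib_right cscale_mult_left cscale_mult_right)
  have sxy: "s (x * y) = co_1 x *\<^sub>C s y + co_e x *\<^sub>C s y + co_1 y *\<^sub>C s x"
    unfolding s_def
    by (simp add: cscale_sum_right cscale_add_left sum.distrib distrib_left distrib_right mult.commute)
  have oc: "of_coords x = co_1 x *\<^sub>C 1 + co_e x *\<^sub>C K_e + s x" for x
    by (simp add: of_coords_def s_def)
  show ?thesis
    unfolding oc sxy
    by (simp add: distrib_left distrib_right cscale_mult_left cscale_mult_right es se ss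
        cscale_add_left cscale_add_right mult.commute)
qed

lemma of_coords_to_coords: "of_coords (to_coords x) = x"
proof (induction x rule: kalg_induct)
  case (alpha i)
  have "(\<Sum>k\<in>UNIV. (if k = i then 1 else 0) *\<^sub>C K_alpha k)
      = (\<Sum>k\<in>UNIV. if k = i then K_alpha i else (0 :: 'a kalg))"
    by (rule sum.cong) auto
  then show ?case by (simp add: of_coords_def)
qed (simp_all add: of_coords_add of_coords_mult of_coords_scale, simp_all add: of_coords_def)

lemma kalg_eq_iff: "x = y \<longleftrightarrow> to_coords x = to_coords y" for x y :: "'n::finite kalg"
  by (metis of_coords_to_coords)

lemma kalg_eqI_coords:
  fixes x y :: "'n::finite kalg"
  assumes "co_1 (to_coords x) = co_1 (to_coords y)" "co_e (to_coords x) = co_e (to_coords y)"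
    "\<And>k. co_a (to_coords x) k = co_a (to_coords y) k"
  shows "x = y"
  using assms by (simp add: kalg_eq_iff coords_eqI)

lemma to_coords_of_coords [simp]: "to_coords (of_coords x) = x"
  by (rule coords_eqI) (simp_all add: of_coords_def if_distrib cong: if_cong)

lifting_forget kalg.lifting

section \<open>The involution and the derivations\<close>

definition is_star :: "('a::complex_algebra_1 \<Rightarrow> 'a) \<Rightarrow> bool" where
  "is_star s \<longleftrightarrow>
     (\<forall>x y. s (x + y) = s x + s y) \<and> (\<forall>c x. s (c *\<^sub>C x) = cnj c *\<^sub>C s x) \<and>
     (\<forall>x y. s (x * y) = s y * s x) \<and> (\<forall>x. s (s x) = x)"

definition is_kstar :: "('n::finite kalg \<Rightarrow> 'n kalg) \<Rightarrow> bool" where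
  "is_kstar s \<longleftrightarrow> is_star s \<and> s K_e = 1 - K_e \<and> (\<forall>k. s (K_alpha k) = K_alpha k)"

text \<open>The involution is the unique one with the prescribed values; see \<open>ex1_kstar\<close>.\<close>

definition kstar :: "'n::finite kalg \<Rightarrow> 'n kalg" where
  "kstar = (THE s. is_kstar s)"

lemma ex1_kstar: "\<exists>!s :: 'n::finite kalg \<Rightarrow> 'n kalg. is_kstar s"
proof (rule ex_ex1I)
  define s :: "'n kalg \<Rightarrow> 'n kalg" where
    "s x = of_coords (Coords (cnj (co_1 (to_coords x)) + cnj (co_e (to_coords x)))
       (- cnj (co_e (to_coords x))) (\<lambda>k. cnj (co_a (to_coords x) k)))" for x
  have "is_kstar s"
    unfolding is_kstar_def is_star_def
    by (intro conjI allI; rule kalg_eqI_coords) (simp_all add: s_def algebra_simps)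
  then show "\<exists>s :: 'n kalg \<Rightarrow> 'n kalg. is_kstar s" by (intro exI)
next
  fix s t :: "'n kalg \<Rightarrow> 'n kalg"
  assume s: "is_kstar s" and t: "is_kstar t"
  have one: "u 1 = 1" if "is_kstar u" for u :: "'n kalg \<Rightarrow> 'n kalg"
  proof -
    have "u (1 * u 1) = u (u 1) * u 1" "u (u 1) = 1"
      using that unfolding is_kstar_def is_star_def by blast+
    then show ?thesis by simp
  qed
  have "s x = t x" for x
    by (induction x rule: kalg_induct)
      (use s t one[OF s] one[OF t] in \<open>simp_all add: is_kstar_def is_star_def\<close>)
  then show "s = t" ..
qed

lemma is_kstar_kstar: "is_kstar kstar"
  unfolding kstar_def by (rule theI'[OF ex1_kstar])

lemma kstar_simps [simp]:
  "kstar (x + y) = kstar x + kstar y" "kstar (c *\<^sub>C x) = cnj c *\<^sub>C kstar x"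
  "kstar (x * y) = kstar y * kstar x" "kstar (kstar x) = x"
  "kstar K_e = 1 - K_e" "kstar (K_alpha k) = K_alpha k"
  using is_kstar_kstar by (auto simp: is_kstar_def is_star_def)

lemma kstar_zero [simp]: "kstar 0 = 0"
  using kstar_simps(1)[of 0 0] by (simp del: kstar_simps)

lemma kstar_one [simp]: "kstar 1 = 1"
proof -
  have "kstar (1 * kstar 1) = kstar (kstar 1) * kstar 1" by (rule kstar_simps(3))
  then show ?thesis by simp
qed

lemma kstar_minus [simp]: "kstar (- x) = - kstar x"
  using kstar_simps(2)[of "- 1" x] by (simp add: cscale_minus_left del: kstar_simps)

lemma kstar_diff [simp]: "kstar (x - y) = kstar x - kstar y"
  using kstar_simps(1)[of x "- y"] by (simp del: kstar_simps)

lemma kstar_sum [simp]: "kstar (sum f A) = (\<Sum>i\<in>A. kstar (f i))"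
  by (induction A rule: infinite_finite_induct) simp_all

definition is_derivation :: "('a::complex_algebra_1 \<Rightarrow> 'a) \<Rightarrow> bool" where
  "is_derivation D \<longleftrightarrow>
     (\<forall>x y. D (x + y) = D x + D y) \<and> (\<forall>c x. D (c *\<^sub>C x) = c *\<^sub>C D x) \<and>
     (\<forall>x y. D (x * y) = x * D y + D x * y)"

definition is_partial_tilde :: "'n::finite \<Rightarrow> ('n kalg \<Rightarrow> 'n kalg) \<Rightarrow> bool" where
  "is_partial_tilde i D \<longleftrightarrow> is_derivation D \<and> D K_e = \<i> *\<^sub>C K_alpha i \<and>
     (\<forall>k. D (K_alpha k) = (if i = k then K_alpha i else 0))"

text \<open>The derivation with the prescribed values is unique; see \<open>ex1_partial_tilde\<close>.\<close>

definition partial_tilde :: "'n::finite \<Rightarrow> 'n kalg \<Rightarrow> 'n kalg" where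
  "partial_tilde i = (THE D. is_partial_tilde i D)"

lemma derivation_one:
  assumes "is_derivation D"
  shows "D 1 = 0"
proof -
  have "D (1 * 1) = 1 * D 1 + D 1 * 1" using assms unfolding is_derivation_def by blast
  then show ?thesis by simp
qed

lemma derivation_eqI:
  fixes D D' :: "'n kalg \<Rightarrow> 'n kalg"
  assumes "is_derivation D" "is_derivation D'" "D K_e = D' K_e" "\<And>k. D (K_alpha k) = D' (K_alpha k)"
  shows "D = D'"
proof
  show "D x = D' x" for x
    by (induction x rule: kalg_induct)
      (use assms derivation_one[OF assms(1)] derivation_one[OF assms(2)]
        in \<open>simp_all add: is_derivation_def\<close>)
qed

lemma ex1_partial_tilde: "\<exists>!D :: 'n::finite kalg \<Rightarrow> 'n kalg. is_partial_tilde i D"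
proof (rule ex_ex1I)
  define D :: "'n kalg \<Rightarrow> 'n kalg" where
    "D x = (\<i> * co_e (to_coords x) + co_a (to_coords x) i) *\<^sub>C K_alpha i" for x
  have "is_partial_tilde i D"
    unfolding is_partial_tilde_def is_derivation_def
    by (intro conjI allI; rule kalg_eqI_coords) (simp_all add: D_def algebra_simps)
  then show "\<exists>D :: 'n kalg \<Rightarrow> 'n kalg. is_partial_tilde i D" by (intro exI)
next
  fix D D' :: "'n kalg \<Rightarrow> 'n kalg"
  assume "is_partial_tilde i D" "is_partial_tilde i D'"
  then show "D = D'"
    by (intro derivation_eqI) (simp_all add: is_partial_tilde_def)
qed

lemma is_partial_tilde: "is_partial_tilde i (partial_tilde i)"
  unfolding partial_tilde_def by (rule theI'[OF ex1_partial_tilde])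

lemma partial_tilde_simps [simp]:
  "partial_tilde i (x + y) = partial_tilde i x + partial_tilde i y"
  "partial_tilde i (c *\<^sub>C x) = c *\<^sub>C partial_tilde i x"
  "partial_tilde i (x * y) = x * partial_tilde i y + partial_tilde i x * y"
  "partial_tilde i K_e = \<i> *\<^sub>C K_alpha i"
  "partial_tilde i (K_alpha k) = (if i = k then K_alpha i else 0)"
  using is_partial_tilde[of i] by (simp_all add: is_partial_tilde_def is_derivation_def)

lemma partial_tilde_one [simp]: "partial_tilde i 1 = 0"
  using is_partial_tilde[of i] by (simp add: is_partial_tilde_def derivation_one)

lemma partial_tilde_zero [simp]: "partial_tilde i 0 = 0"
  using partial_tilde_simps(2)[of i 0 0] by simp

lemma partial_tilde_minus [simp]: "partial_tilde i (- x) = - partial_tilde i x"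
  using partial_tilde_simps(1)[of i x "- x"] by (simp add: eq_neg_iff_add_eq_0 add.commute)

lemma partial_tilde_diff [simp]: "partial_tilde i (x - y) = partial_tilde i x - partial_tilde i y"
  using partial_tilde_simps(1)[of i x "- y"] by simp

lemma partial_tilde_sum [simp]: "partial_tilde i (sum f A) = (\<Sum>j\<in>A. partial_tilde i (f j))"
  by (induction A rule: infinite_finite_induct) simp_all

lemma partial_tilde_star: "kstar (partial_tilde i (kstar x)) = partial_tilde i x"
  by (induction x rule: kalg_induct) (simp_all add: cscale_minus_left)

lemma partial_tilde_commute: "partial_tilde i (partial_tilde j x) = partial_tilde j (partial_tilde i x)"
  by (induction x rule: kalg_induct) (simp_all add: algebra_simps)

typedef 'n lie = "{D :: 'n::finite kalg \<Rightarrow> 'n kalg.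
    \<exists>c. D = (\<lambda>x. \<Sum>i\<in>UNIV. c i *\<^sub>C partial_tilde i x)}"
  morphisms apply_der Abs_lie
  by blast

setup_lifting type_definition_lie

lemma lie_eqI: "(\<And>x. apply_der d x = apply_der d' x) \<Longrightarrow> d = d'"
  by (simp add: apply_der_inject[symmetric] fun_eq_iff)

instantiation lie :: (finite) complex_vector
begin

lift_definition zero_lie :: "'n::finite lie" is "\<lambda>x. 0"
  by (rule exI[of _ "\<lambda>_. 0"]) simp
lift_definition plus_lie :: "'n::finite lie \<Rightarrow> 'n lie \<Rightarrow> 'n lie" is "\<lambda>D D' x. D x + D' x"
proof -
  fix D D' :: "'n kalg \<Rightarrow> 'n kalg"
  assume "\<exists>c. D = (\<lambda>x. \<Sum>i\<in>UNIV. c i *\<^sub>C partial_tilde i x)"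
    and "\<exists>c. D' = (\<lambda>x. \<Sum>i\<in>UNIV. c i *\<^sub>C partial_tilde i x)"
  then obtain c c' where "D = (\<lambda>x. \<Sum>i\<in>UNIV. c i *\<^sub>C partial_tilde i x)"
    and "D' = (\<lambda>x. \<Sum>i\<in>UNIV. c' i *\<^sub>C partial_tilde i x)" by blast
  then have "(\<lambda>x. D x + D' x) = (\<lambda>x. \<Sum>i\<in>UNIV. (c i + c' i) *\<^sub>C partial_tilde i x)"
    by (simp add: cscale_add_left sum.distrib)
  then show "\<exists>c. (\<lambda>x. D x + D' x) = (\<lambda>x. \<Sum>i\<in>UNIV. c i *\<^sub>C partial_tilde i x)"
    by (intro exI)
qed
lift_definition uminus_lie :: "'n::finite lie \<Rightarrow> 'n lie" is "\<lambda>D x. - D x"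
proof -
  fix D :: "'n kalg \<Rightarrow> 'n kalg"
  assume "\<exists>c. D = (\<lambda>x. \<Sum>i\<in>UNIV. c i *\<^sub>C partial_tilde i x)"
  then obtain c where "D = (\<lambda>x. \<Sum>i\<in>UNIV. c i *\<^sub>C partial_tilde i x)" ..
  then have "(\<lambda>x. - D x) = (\<lambda>x. \<Sum>i\<in>UNIV. (- c i) *\<^sub>C partial_tilde i x)"
    by (simp add: cscale_minus_left sum_negf)
  then show "\<exists>c. (\<lambda>x. - D x) = (\<lambda>x. \<Sum>i\<in>UNIV. c i *\<^sub>C partial_tilde i x)"
    by (intro exI)
qed
definition minus_lie :: "'n::finite lie \<Rightarrow> 'n lie \<Rightarrow> 'n lie" where "minus_lie d d' = d + - d'"
lift_definition cscale_lie :: "complex \<Rightarrow> 'n::finite lie \<Rightarrow> 'n lie" is "\<lambda>c D x. c *\<^sub>C D x"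
proof -
  fix a :: complex and D :: "'n kalg \<Rightarrow> 'n kalg"
  assume "\<exists>c. D = (\<lambda>x. \<Sum>i\<in>UNIV. c i *\<^sub>C partial_tilde i x)"
  then obtain c where "D = (\<lambda>x. \<Sum>i\<in>UNIV. c i *\<^sub>C partial_tilde i x)" ..
  then have "(\<lambda>x. a *\<^sub>C D x) = (\<lambda>x. \<Sum>i\<in>UNIV. (a * c i) *\<^sub>C partial_tilde i x)"
    by (simp add: cscale_sum_right)
  then show "\<exists>c. (\<lambda>x. a *\<^sub>C D x) = (\<lambda>x. \<Sum>i\<in>UNIV. c i *\<^sub>C partial_tilde i x)"
    by (intro exI)
qed

instance
  by standard
    (rule lie_eqI, simp add: zero_lie.rep_eq plus_lie.rep_eq uminus_lie.rep_eq cscale_lie.rep_eq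
      minus_lie_def algebra_simps cscale_add_right cscale_add_left)+

end

lift_definition lie_basis :: "'n \<Rightarrow> 'n::finite lie" is partial_tilde
proof -
  fix i :: 'n
  have "partial_tilde i = (\<lambda>x. \<Sum>j\<in>UNIV. (if j = i then 1 else 0) *\<^sub>C partial_tilde j x)"
    by (simp add: fun_eq_iff if_distrib[of "\<lambda>c. c *\<^sub>C _"] cong: if_cong)
  then show "\<exists>c. partial_tilde i = (\<lambda>x. \<Sum>j\<in>UNIV. c j *\<^sub>C partial_tilde j x)"
    by (intro exI)
qed

lift_definition lie_bracket :: "'n::finite lie \<Rightarrow> 'n lie \<Rightarrow> 'n lie"
  is "\<lambda>D D' x. D (D' x) - D' (D x)"
proof -
  fix D D' :: "'n kalg \<Rightarrow> 'n kalg"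
  assume "\<exists>c. D = (\<lambda>x. \<Sum>i\<in>UNIV. c i *\<^sub>C partial_tilde i x)"
    and "\<exists>c. D' = (\<lambda>x. \<Sum>i\<in>UNIV. c i *\<^sub>C partial_tilde i x)"
  then obtain c c' where D: "D = (\<lambda>x. \<Sum>i\<in>UNIV. c i *\<^sub>C partial_tilde i x)"
    and D': "D' = (\<lambda>x. \<Sum>i\<in>UNIV. c' i *\<^sub>C partial_tilde i x)" by blast
  have "D (D' x) = D' (D x)" for x
    unfolding D D'
    by (simp add: cscale_sum_right) (subst sum.swap, simp add: mult.commute partial_tilde_commute)
  then have "(\<lambda>x. D (D' x) - D' (D x)) = (\<lambda>x. \<Sum>i\<in>UNIV. 0 *\<^sub>C partial_tilde i x)"
    by simp
  then show "\<exists>c. (\<lambda>x. D (D' x) - D' (D x)) = (\<lambda>x. \<Sum>i\<in>UNIV. c i *\<^sub>C partial_tilde i x)"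
    by (intro exI)
qed

lift_definition lie_star :: "'n::finite lie \<Rightarrow> 'n lie" is "\<lambda>D x. kstar (D (kstar x))"
proof -
  fix D :: "'n kalg \<Rightarrow> 'n kalg"
  assume "\<exists>c. D = (\<lambda>x. \<Sum>i\<in>UNIV. c i *\<^sub>C partial_tilde i x)"
  then obtain c where "D = (\<lambda>x. \<Sum>i\<in>UNIV. c i *\<^sub>C partial_tilde i x)" ..
  then have "(\<lambda>x. kstar (D (kstar x))) = (\<lambda>x. \<Sum>i\<in>UNIV. cnj (c i) *\<^sub>C partial_tilde i x)"
    by (simp add: partial_tilde_star)
  then show "\<exists>c. (\<lambda>x. kstar (D (kstar x))) = (\<lambda>x. \<Sum>i\<in>UNIV. c i *\<^sub>C partial_tilde i x)"
    by (intro exI)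
qed

lemma apply_der_expand:
  obtains c where "\<And>x. apply_der d x = (\<Sum>i\<in>UNIV. c i *\<^sub>C partial_tilde i x)"
proof -
  obtain c where "apply_der d = (\<lambda>x. \<Sum>i\<in>UNIV. c i *\<^sub>C partial_tilde i x)"
    using apply_der[of d] by blast
  then show thesis using that by (simp add: fun_eq_iff)
qed

lemma apply_der_simps [simp]:
  "apply_der (d + d') x = apply_der d x + apply_der d' x"
  "apply_der (c *\<^sub>C d) x = c *\<^sub>C apply_der d x"
  "apply_der (lie_basis i) x = partial_tilde i x"
  "apply_der (lie_star d) x = kstar (apply_der d (kstar x))"
  by (transfer; simp)+

lemma apply_der_linear [simp]:
  "apply_der d (x + y) = apply_der d x + apply_der d y"
  "apply_der d (c *\<^sub>C x) = c *\<^sub>C apply_der d x"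
  "apply_der d (x * y) = x * apply_der d y + apply_der d x * y"
proof -
  obtain c where c: "\<And>x. apply_der d x = (\<Sum>i\<in>UNIV. c i *\<^sub>C partial_tilde i x)"
    using apply_der_expand by blast
  show "apply_der d (x + y) = apply_der d x + apply_der d y"
    by (simp add: c cscale_add_right sum.distrib)
  show "apply_der d (c *\<^sub>C x) = c *\<^sub>C apply_der d x" for c
    by (simp add: c cscale_sum_right mult.commute)
  show "apply_der d (x * y) = x * apply_der d y + apply_der d x * y"
    by (simp add: c cscale_add_right sum.distrib sum_distrib_left sum_distrib_right
        cscale_mult_left cscale_mult_right)
qed

lifting_forget lie.lifting

section \<open>One-forms\<close>

typedef 'n form = "{w :: 'n::finite lie \<Rightarrow> 'n kalg.
    \<exists>m a b. w = (\<lambda>d. \<Sum>k<(m::nat). a k * apply_der d (b k))}"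
  morphisms apply_form Abs_form
  by blast

setup_lifting type_definition_form

lemma form_eqI: "(\<And>d. apply_form w d = apply_form w' d) \<Longrightarrow> w = w'"
  by (simp add: apply_form_inject[symmetric] fun_eq_iff)

lemma form_rangeI:
  assumes "w = (\<lambda>d. \<Sum>k<(m::nat). a k * apply_der d (b k))"
  shows "\<exists>m a b. w = (\<lambda>d. \<Sum>k<(m::nat). a k * apply_der d (b k))"
  using assms by blast

lemma form_range_add:
  assumes "\<exists>m a b. v = (\<lambda>d. \<Sum>k<(m::nat). a k * apply_der d (b k))"
    and "\<exists>m a b. w = (\<lambda>d. \<Sum>k<(m::nat). a k * apply_der d (b k))"
  shows "\<exists>m a b. (\<lambda>d. v d + w d) = (\<lambda>d. \<Sum>k<(m::nat). a k * apply_der d (b k))"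
proof -
  obtain m a b where v: "v = (\<lambda>d. \<Sum>k<(m::nat). a k * apply_der d (b k))"
    using assms(1) by blast
  obtain m' a' b' where w: "w = (\<lambda>d. \<Sum>k<(m'::nat). a' k * apply_der d (b' k))"
    using assms(2) by blast
  let ?a = "\<lambda>k. if k < m then a k else a' (k - m)" and ?b = "\<lambda>k. if k < m then b k else b' (k - m)"
  have "v d + w d = (\<Sum>k<m + m'. ?a k * apply_der d (?b k))" for d
  proof -
    let ?f = "\<lambda>k. ?a k * apply_der d (?b k)"
    have "sum ?f {0..<m + m'} = sum ?f {0..<m} + sum ?f {m..<m + m'}"
      by (rule sum.atLeastLessThan_concat[symmetric]) simp_all
    also have "sum ?f {m..<m + m'} = (\<Sum>k\<in>{0..<m'}. ?f (k + m))"
      using sum.shift_bounds_nat_ivl[of ?f 0 m m'] by (simp add: add.commute)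
    also have "\<dots> = w d" by (simp add: w lessThan_atLeast0)
    also have "sum ?f {0..<m} = v d" by (simp add: v lessThan_atLeast0)
    finally show ?thesis by (simp only: lessThan_atLeast0)
  qed
  then have "(\<lambda>d. v d + w d) = (\<lambda>d. \<Sum>k<m + m'. ?a k * apply_der d (?b k))" ..
  then show ?thesis by (rule form_rangeI)
qed

lemma form_range_left:
  assumes "\<exists>m a b. w = (\<lambda>d. \<Sum>k<(m::nat). a k * apply_der d (b k))"
  shows "\<exists>m a b. (\<lambda>d. x * w d) = (\<lambda>d. \<Sum>k<(m::nat). a k * apply_der d (b k))"
proof -
  obtain m a b where w: "w = (\<lambda>d. \<Sum>k<(m::nat). a k * apply_der d (b k))"
    using assms by blast
  then have "(\<lambda>d. x * w d) = (\<lambda>d. \<Sum>k<m. (x * a k) * apply_der d (b k))"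
    by (simp add: sum_distrib_left mult.assoc)
  then show ?thesis by (rule form_rangeI)
qed

lemma form_range_sum:
  assumes "\<And>k. k < (l::nat) \<Longrightarrow> \<exists>m a b. w k = (\<lambda>d. \<Sum>k<(m::nat). a k * apply_der d (b k))"
  shows "\<exists>m a b. (\<lambda>d. \<Sum>k<l. w k d) = (\<lambda>d. \<Sum>k<(m::nat). a k * apply_der d (b k))"
  using assms
proof (induction l)
  case 0
  show ?case by (rule form_rangeI[where m = 0]) simp
next
  case (Suc l)
  show ?case using form_range_add[OF Suc.IH Suc.prems[of l]] Suc.prems by simp
qed

lemma form_range_single:
  "\<exists>m a b. (\<lambda>d. x * apply_der d y) = (\<lambda>d. \<Sum>k<(m::nat). a k * apply_der d (b k))"
  by (rule form_rangeI[where m = 1 and a = "\<lambda>_. x" and b = "\<lambda>_. y"]) simp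

text \<open>Right multiples stay in the additive span because \<open>(a db)c = a d(bc) - ab dc\<close>.\<close>

lemma form_range_right:
  assumes "\<exists>m a b. w = (\<lambda>d. \<Sum>k<(m::nat). a k * apply_der d (b k))"
  shows "\<exists>m a b. (\<lambda>d. w d * x) = (\<lambda>d. \<Sum>k<(m::nat). a k * apply_der d (b k))"
proof -
  obtain m a b where w: "w = (\<lambda>d. \<Sum>k<(m::nat). a k * apply_der d (b k))"
    using assms by blast
  have "w d * x = (\<Sum>k<m. a k * apply_der d (b k * x) + (- (a k * b k)) * apply_der d x)" for d
    by (simp add: w sum_distrib_right distrib_left mult.assoc)
  then have eq: "(\<lambda>d. w d * x)
      = (\<lambda>d. \<Sum>k<m. a k * apply_der d (b k * x) + (- (a k * b k)) * apply_der d x)" ..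
  show ?thesis
    unfolding eq by (intro form_range_sum form_range_add form_range_single)
qed

lemma form_range_star:
  assumes "\<exists>m a b. w = (\<lambda>d. \<Sum>k<(m::nat). a k * apply_der d (b k))"
  shows "\<exists>m a b. (\<lambda>d. kstar (w (lie_star d))) = (\<lambda>d. \<Sum>k<(m::nat). a k * apply_der d (b k))"
proof -
  obtain m a b where w: "w = (\<lambda>d. \<Sum>k<(m::nat). a k * apply_der d (b k))"
    using assms by blast
  have eq: "(\<lambda>d. kstar (w (lie_star d))) = (\<lambda>d. \<Sum>k<m. (1 * apply_der d (kstar (b k))) * kstar (a k))"
    by (simp add: w)
  show ?thesis
    unfolding eq by (intro form_range_sum form_range_right form_range_single)
qed

lift_definition exterior_d :: "'n::finite kalg \<Rightarrow> 'n form" is "\<lambda>b d. apply_der d b"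
  using form_range_single[of 1] by simp

lift_definition form_lmult :: "'n::finite kalg \<Rightarrow> 'n form \<Rightarrow> 'n form"  (infixr "\<cdot>\<^sub>l" 75)
  is "\<lambda>a w d. a * w d"
  by (rule form_range_left)

lift_definition form_rmult :: "'n::finite form \<Rightarrow> 'n kalg \<Rightarrow> 'n form"  (infixl "\<cdot>\<^sub>r" 75)
  is "\<lambda>w a d. w d * a"
  by (rule form_range_right)

lift_definition form_star :: "'n::finite form \<Rightarrow> 'n form" is "\<lambda>w d. kstar (w (lie_star d))"
  by (rule form_range_star)

instantiation form :: (finite) complex_vector
begin

lift_definition zero_form :: "'n::finite form" is "\<lambda>d. 0"
  by (rule form_rangeI[where m = 0]) simp
lift_definition plus_form :: "'n::finite form \<Rightarrow> 'n form \<Rightarrow> 'n form" is "\<lambda>v w d. v d + w d"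
  by (rule form_range_add)
lift_definition uminus_form :: "'n::finite form \<Rightarrow> 'n form" is "\<lambda>w d. - w d"
  using form_range_left[where x = "- 1"] by simp
definition minus_form :: "'n::finite form \<Rightarrow> 'n form \<Rightarrow> 'n form" where "minus_form v w = v + - w"
lift_definition cscale_form :: "complex \<Rightarrow> 'n::finite form \<Rightarrow> 'n form" is "\<lambda>c w d. c *\<^sub>C w d"
  using form_range_left[where x = "_ *\<^sub>C 1"] by (simp add: cscale_mult_left)

instance
  by standard
    (rule form_eqI, simp add: zero_form.rep_eq plus_form.rep_eq uminus_form.rep_eq cscale_form.rep_eq
      minus_form_def algebra_simps cscale_add_right cscale_add_left)+

end

lemma apply_form_simps [simp]:
  "apply_form 0 d = 0"
  "apply_form (v + w) d = apply_form v d + apply_form w d"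
  "apply_form (c *\<^sub>C w) d = c *\<^sub>C apply_form w d"
  "apply_form (a \<cdot>\<^sub>l w) d = a * apply_form w d"
  "apply_form (w \<cdot>\<^sub>r a) d = apply_form w d * a"
  "apply_form (form_star w) d = kstar (apply_form w (lie_star d))"
  "apply_form (exterior_d a) d = apply_der d a"
  by (transfer; simp)+

definition exterior_d2 :: "'n::finite form \<Rightarrow> 'n lie \<Rightarrow> 'n lie \<Rightarrow> 'n kalg" where
  "exterior_d2 w d d' =
     apply_der d (apply_form w d') - apply_der d' (apply_form w d) - apply_form w (lie_bracket d d')"

section \<open>Hermitian forms and connections\<close>

definition left_hermitian_form :: "('n::finite form \<Rightarrow> 'n form \<Rightarrow> 'n kalg) \<Rightarrow> bool" where
  "left_hermitian_form h \<longleftrightarrow>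
     (\<forall>v v' w. h (v + v') w = h v w + h v' w) \<and> (\<forall>v w w'. h v (w + w') = h v w + h v w') \<and>
     (\<forall>a v w. h (a \<cdot>\<^sub>l v) w = a * h v w) \<and> (\<forall>v w. kstar (h v w) = h w v)"

definition complex_bilinear ::
    "('a::complex_vector \<Rightarrow> 'b::complex_vector \<Rightarrow> 'c::complex_vector) \<Rightarrow> bool" where
  "complex_bilinear f \<longleftrightarrow>
     (\<forall>x x' y. f (x + x') y = f x y + f x' y) \<and> (\<forall>c x y. f (c *\<^sub>C x) y = c *\<^sub>C f x y) \<and>
     (\<forall>x y y'. f x (y + y') = f x y + f x y') \<and> (\<forall>c x y. f x (c *\<^sub>C y) = c *\<^sub>C f x y)"

definition left_connection :: "('n::finite lie \<Rightarrow> 'n form \<Rightarrow> 'n form) \<Rightarrow> bool" where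
  "left_connection nabla \<longleftrightarrow>
     (\<forall>d d' w. nabla (d + d') w = nabla d w + nabla d' w) \<and>
     (\<forall>d w w'. nabla d (w + w') = nabla d w + nabla d w') \<and>
     (\<forall>c d w. nabla (c *\<^sub>C d) w = c *\<^sub>C nabla d w) \<and>
     (\<forall>d a w. nabla d (a \<cdot>\<^sub>l w) = a \<cdot>\<^sub>l nabla d w + apply_der d a \<cdot>\<^sub>l w)"

definition right_connection :: "('n::finite lie \<Rightarrow> 'n form \<Rightarrow> 'n form) \<Rightarrow> bool" where
  "right_connection nabla \<longleftrightarrow>
     (\<forall>d d' w. nabla (d + d') w = nabla d w + nabla d' w) \<and>
     (\<forall>d w w'. nabla d (w + w') = nabla d w + nabla d w') \<and>
     (\<forall>c d w. nabla (c *\<^sub>C d) w = c *\<^sub>C nabla d w) \<and>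
     (\<forall>d a w. nabla d (w \<cdot>\<^sub>r a) = nabla d w \<cdot>\<^sub>r a + w \<cdot>\<^sub>r apply_der d a)"

definition bimodule_connection :: "('n::finite lie \<Rightarrow> 'n form \<Rightarrow> 'n form) \<Rightarrow> bool" where
  "bimodule_connection nabla \<longleftrightarrow> left_connection nabla \<and> right_connection nabla"

text \<open>
  The definition asks only for a left connection; the right Leibniz rule then follows, see
  \<open>star_bimodule_connection_imp_bimodule_connection\<close>.
\<close>

definition star_bimodule_connection :: "('n::finite lie \<Rightarrow> 'n form \<Rightarrow> 'n form) \<Rightarrow> bool" where
  "star_bimodule_connection nabla \<longleftrightarrow> left_connection nabla \<and>
     (\<forall>d w. form_star (nabla d w) = nabla (lie_star d) (form_star w))"

definition torsion_free :: "('n::finite lie \<Rightarrow> 'n form \<Rightarrow> 'n form) \<Rightarrow> bool" where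
  "torsion_free nabla \<longleftrightarrow>
     (\<forall>w d d'. apply_form (nabla d w) d' - apply_form (nabla d' w) d - exterior_d2 w d d' = 0)"

definition compatible ::
    "('n::finite lie \<Rightarrow> 'n form \<Rightarrow> 'n form) \<Rightarrow> ('n form \<Rightarrow> 'n form \<Rightarrow> 'n kalg) \<Rightarrow> bool" where
  "compatible nabla h \<longleftrightarrow>
     (\<forall>d v w. apply_der d (h v w) = h (nabla d v) w + h v (nabla (lie_star d) w))"

definition star_bimodule_levi_civita ::
    "('n::finite lie \<Rightarrow> 'n form \<Rightarrow> 'n form) \<Rightarrow> ('n form \<Rightarrow> 'n form \<Rightarrow> 'n kalg) \<Rightarrow> bool" where
  "star_bimodule_levi_civita nabla h \<longleftrightarrow>
     star_bimodule_connection nabla \<and> torsion_free nabla \<and> compatible nabla h"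

section \<open>Existence and uniqueness of the data\<close>

lemma partial_tilde_eq:
  "partial_tilde i x = (\<i> * co_e (to_coords x) + co_a (to_coords x) i) *\<^sub>C K_alpha i"
proof -
  have "is_partial_tilde i (\<lambda>x. (\<i> * co_e (to_coords x) + co_a (to_coords x) i) *\<^sub>C K_alpha i)"
    unfolding is_partial_tilde_def is_derivation_def
    by (intro conjI allI; rule kalg_eqI_coords) (simp_all add: algebra_simps)
  from the1_equality[OF ex1_partial_tilde, OF this] show ?thesis
    unfolding partial_tilde_def by (rule fun_cong)
qed

lemma sum_delta_simps [simp]:
  fixes x :: "'n::finite \<Rightarrow> 'a::complex_vector" and y :: "'n \<Rightarrow> complex"
  shows "(\<Sum>j\<in>UNIV. c j *\<^sub>C (if i = j then x j else 0)) = c i *\<^sub>C x i"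
    and "(\<Sum>j\<in>UNIV. c j *\<^sub>C (if j = i then x j else 0)) = c i *\<^sub>C x i"
    and "(\<Sum>j\<in>UNIV. c j * (if i = j then y j else 0)) = c i * y i"
    and "(\<Sum>j\<in>UNIV. c j * (if j = i then y j else 0)) = c i * y i"
proof -
  have "(\<Sum>j\<in>UNIV. c j *\<^sub>C (if i = j then x j else 0)) = (\<Sum>j\<in>UNIV. if i = j then c j *\<^sub>C x j else 0)"
    "(\<Sum>j\<in>UNIV. c j *\<^sub>C (if j = i then x j else 0)) = (\<Sum>j\<in>UNIV. if j = i then c j *\<^sub>C x j else 0)"
    "(\<Sum>j\<in>UNIV. c j * (if i = j then y j else 0)) = (\<Sum>j\<in>UNIV. if i = j then c j * y j else 0)"
    "(\<Sum>j\<in>UNIV. c j * (if j = i then y j else 0)) = (\<Sum>j\<in>UNIV. if j = i then c j * y j else 0)"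
    by (rule sum.cong; simp)+
  then show "(\<Sum>j\<in>UNIV. c j *\<^sub>C (if i = j then x j else 0)) = c i *\<^sub>C x i"
    and "(\<Sum>j\<in>UNIV. c j *\<^sub>C (if j = i then x j else 0)) = c i *\<^sub>C x i"
    and "(\<Sum>j\<in>UNIV. c j * (if i = j then y j else 0)) = c i * y i"
    and "(\<Sum>j\<in>UNIV. c j * (if j = i then y j else 0)) = c i * y i"
    by simp_all
qed

lemma sum_delta_coords [simp]:
  fixes x :: "'n::finite \<Rightarrow> 'm kalg"
  shows "(\<Sum>j\<in>UNIV. c j *\<^sub>C to_coords (if i = j then x j else 0)) = c i *\<^sub>C to_coords (x i)"
    and "(\<Sum>j\<in>UNIV. c j * co_a (to_coords (if i = j then x j else 0)) k) = c i * co_a (to_coords (x i)) k"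
    and "(\<Sum>j\<in>UNIV. c j * co_a (to_coords (if j = i then x j else 0)) k) = c i * co_a (to_coords (x i)) k"
proof -
  have "(\<Sum>j\<in>UNIV. c j *\<^sub>C to_coords (if i = j then x j else 0))
      = (\<Sum>j\<in>UNIV. c j *\<^sub>C (if i = j then to_coords (x j) else 0))"
    "(\<Sum>j\<in>UNIV. c j * co_a (to_coords (if i = j then x j else 0)) k)
      = (\<Sum>j\<in>UNIV. c j * (if i = j then co_a (to_coords (x j)) k else 0))"
    "(\<Sum>j\<in>UNIV. c j * co_a (to_coords (if j = i then x j else 0)) k)
      = (\<Sum>j\<in>UNIV. c j * (if j = i then co_a (to_coords (x j)) k else 0))"
    by (rule sum.cong; simp)+
  then show "(\<Sum>j\<in>UNIV. c j *\<^sub>C to_coords (if i = j then x j else 0)) = c i *\<^sub>C to_coords (x i)"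
    and "(\<Sum>j\<in>UNIV. c j * co_a (to_coords (if i = j then x j else 0)) k) = c i * co_a (to_coords (x i)) k"
    and "(\<Sum>j\<in>UNIV. c j * co_a (to_coords (if j = i then x j else 0)) k) = c i * co_a (to_coords (x i)) k"
    by simp_all
qed

definition lie_coeff :: "'n::finite lie \<Rightarrow> 'n \<Rightarrow> complex" where
  "lie_coeff d k = co_a (to_coords (apply_der d (K_alpha k))) k"

definition form_coeff :: "'n::finite form \<Rightarrow> 'n \<Rightarrow> complex" where
  "form_coeff w k = co_a (to_coords (apply_form w (lie_basis k))) k"

lemma apply_der_coeff: "apply_der d x = (\<Sum>k\<in>UNIV. lie_coeff d k *\<^sub>C partial_tilde k x)"
proof -
  obtain c where c: "\<And>x. apply_der d x = (\<Sum>i\<in>UNIV. c i *\<^sub>C partial_tilde i x)"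
    using apply_der_expand by blast
  have "lie_coeff d k = c k" for k
    by (simp add: lie_coeff_def c)
  then show ?thesis by (simp add: c)
qed

lemma apply_der_sum [simp]: "apply_der (sum f A) x = (\<Sum>i\<in>A. apply_der (f i) x)"
  by (induction A rule: infinite_finite_induct) (simp_all add: zero_lie.rep_eq)

lemma apply_form_sum [simp]: "apply_form (sum f A) d = (\<Sum>i\<in>A. apply_form (f i) d)"
  by (induction A rule: infinite_finite_induct) simp_all

lemma lie_expand: "d = (\<Sum>k\<in>UNIV. lie_coeff d k *\<^sub>C lie_basis k)"
  by (rule lie_eqI) (simp add: apply_der_coeff[of d])

lemma mult_K_alpha: "a * K_alpha k = (co_1 (to_coords a) + co_e (to_coords a)) *\<^sub>C K_alpha k"
  for a :: "'n::finite kalg"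
  by (rule kalg_eqI_coords) simp_all

lemma apply_der_alpha: "apply_der d (K_alpha k) = lie_coeff d k *\<^sub>C K_alpha k"
  by (simp add: apply_der_coeff[of d])

lemma form_span: "\<exists>c. \<forall>d. apply_form w d = (\<Sum>k\<in>UNIV. c k *\<^sub>C apply_der d (K_alpha k))"
proof -
  obtain m a b where w: "apply_form w = (\<lambda>d. \<Sum>j<(m::nat). a j * apply_der d (b j))"
    using apply_form[of w] by blast
  define f where "f = (\<lambda>j k. (\<i> * co_e (to_coords (b j)) + co_a (to_coords (b j)) k)
    * (co_1 (to_coords (a j)) + co_e (to_coords (a j))))"
  have "a j * apply_der d (b j) = (\<Sum>k\<in>UNIV. f j k *\<^sub>C apply_der d (K_alpha k))" for j d
    by (simp add: apply_der_coeff[of d "b j"] partial_tilde_eq[of _ "b j"] apply_der_alpha f_def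
        sum_distrib_left cscale_mult_right mult_K_alpha ac_simps)
  then have "apply_form w d = (\<Sum>j<m. \<Sum>k\<in>UNIV. f j k *\<^sub>C apply_der d (K_alpha k))" for d
    by (simp add: w)
  also have "(\<Sum>j<m. \<Sum>k\<in>UNIV. f j k *\<^sub>C apply_der d (K_alpha k))
      = (\<Sum>k\<in>UNIV. (\<Sum>j<m. f j k) *\<^sub>C apply_der d (K_alpha k))" for d
  proof -
    have "sum g A *\<^sub>C (x :: 'a kalg) = (\<Sum>j\<in>A. g j *\<^sub>C x)" for g x and A :: "nat set"
      by (induction A rule: infinite_finite_induct) (simp_all add: cscale_add_left)
    then show ?thesis by (simp add: sum.swap[of _ UNIV])
  qed
  finally have "\<forall>d. apply_form w d = (\<Sum>k\<in>UNIV. (\<Sum>j<m. f j k) *\<^sub>C apply_der d (K_alpha k))"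
    by blast
  then show ?thesis by (rule exI[where x = "\<lambda>k. \<Sum>j<m. f j k"])
qed

lemma form_expand: "w = (\<Sum>k\<in>UNIV. form_coeff w k *\<^sub>C exterior_d (K_alpha k))"
proof -
  obtain c where c: "\<And>d. apply_form w d = (\<Sum>k\<in>UNIV. c k *\<^sub>C apply_der d (K_alpha k))"
    using form_span[of w] by blast
  have "form_coeff w k = c k" for k
    by (simp add: form_coeff_def c)
  then show ?thesis by (intro form_eqI) (simp add: c)
qed

lemma lie_coeff_simps [simp]:
  "lie_coeff (d + d') k = lie_coeff d k + lie_coeff d' k"
  "lie_coeff (c *\<^sub>C d) k = c * lie_coeff d k"
  "lie_coeff (lie_basis i) k = (if k = i then 1 else 0)"
  by (simp_all add: lie_coeff_def)

lemma form_coeff_simps [simp]: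
  "form_coeff (v + w) k = form_coeff v k + form_coeff w k"
  "form_coeff (c *\<^sub>C w) k = c * form_coeff w k"
  "form_coeff (exterior_d (K_alpha i)) k = (if k = i then 1 else 0)"
  by (simp_all add: form_coeff_def)

lemma form_coeff_lmult:
  "form_coeff (a \<cdot>\<^sub>l w) k = (co_1 (to_coords a) + co_e (to_coords a)) * form_coeff w k"
proof -
  have "co_1 (to_coords (apply_form w d)) = 0" for d
    by (subst form_expand[of w]) (simp add: apply_der_alpha)
  then show ?thesis by (simp add: form_coeff_def)
qed

lemma form_coeff_zero [simp]: "form_coeff 0 k = 0"
  by (simp add: form_coeff_def)

lemma form_coeff_sum [simp]: "form_coeff (sum f A) k = (\<Sum>i\<in>A. form_coeff (f i) k)"
  by (induction A rule: infinite_finite_induct) simp_all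

lemma exterior_d_alpha_basis: "\<exists>!c. w = (\<Sum>k\<in>UNIV. c k *\<^sub>C exterior_d (K_alpha k))"
proof (rule ex1I)
  show "w = (\<Sum>k\<in>UNIV. form_coeff w k *\<^sub>C exterior_d (K_alpha k))" by (rule form_expand)
next
  fix c assume w: "w = (\<Sum>k\<in>UNIV. c k *\<^sub>C exterior_d (K_alpha k))"
  have "form_coeff w k = c k" for k
    by (subst w) simp
  then show "c = form_coeff w" by (simp add: fun_eq_iff)
qed

lemma ex1_left_hermitian_form:
  fixes lam :: "'n::finite \<Rightarrow> real"
  shows "\<exists>!h. left_hermitian_form h \<and>
    (\<forall>i j. h (exterior_d (K_alpha i)) (exterior_d (K_alpha j))
       = (if i = j then complex_of_real (lam i) *\<^sub>C K_alpha i else 0))"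
proof (rule ex_ex1I)
  define h where "h v w = (\<Sum>k\<in>UNIV. (form_coeff v k * cnj (form_coeff w k) * complex_of_real (lam k))
    *\<^sub>C (K_alpha k :: 'n kalg))" for v w
  have "h (v + v') w = h v w + h v' w" for v v' w
    by (simp add: h_def distrib_right cscale_add_left sum.distrib)
  moreover have "h v (w + w') = h v w + h v w'" for v w w'
    by (simp add: h_def distrib_left distrib_right cscale_add_left sum.distrib)
  moreover have "h (a \<cdot>\<^sub>l v) w = a * h v w" for a v w
    unfolding h_def sum_distrib_left
    by (rule sum.cong) (simp_all add: form_coeff_lmult cscale_mult_right mult_K_alpha mult.assoc mult.left_commute mult.commute)
  moreover have "kstar (h v w) = h w v" for v w
    by (simp add: h_def mult.commute)
  ultimately have "left_hermitian_form h"
    by (simp add: left_hermitian_form_def)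
  moreover have "h (exterior_d (K_alpha i)) (exterior_d (K_alpha j))
       = (if i = j then complex_of_real (lam i) *\<^sub>C K_alpha i else 0)" for i j
    by (rule kalg_eqI_coords) (auto simp: h_def)
  ultimately show "\<exists>h. left_hermitian_form h \<and>
    (\<forall>i j. h (exterior_d (K_alpha i)) (exterior_d (K_alpha j))
       = (if i = j then complex_of_real (lam i) *\<^sub>C K_alpha i else 0))" by blast
next
  fix h h' :: "'n form \<Rightarrow> 'n form \<Rightarrow> 'n kalg"
  assume h: "left_hermitian_form h \<and>
    (\<forall>i j. h (exterior_d (K_alpha i)) (exterior_d (K_alpha j))
       = (if i = j then complex_of_real (lam i) *\<^sub>C K_alpha i else 0))"
    and h': "left_hermitian_form h' \<and>
    (\<forall>i j. h' (exterior_d (K_alpha i)) (exterior_d (K_alpha j))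
       = (if i = j then complex_of_real (lam i) *\<^sub>C K_alpha i else 0))"
  have lm: "c *\<^sub>C v = (c *\<^sub>C 1) \<cdot>\<^sub>l v" for c and v :: "'n form"
    by (rule form_eqI) (simp add: cscale_mult_left)
  have eq: "g v w = (\<Sum>k\<in>UNIV. \<Sum>l\<in>UNIV. (form_coeff v k * cnj (form_coeff w l))
      *\<^sub>C g (exterior_d (K_alpha k)) (exterior_d (K_alpha l)))"
    if "left_hermitian_form g" for g and v w :: "'n form"
  proof -
    from that have a1: "g (x + y) z = g x z + g y z" and a2: "g z (x + y) = g z x + g z y"
      and l: "g (a \<cdot>\<^sub>l x) y = a * g x y" and st: "kstar (g x y) = g y x" for a x y z
      by (auto simp: left_hermitian_form_def)
    have s1: "g (c *\<^sub>C x) y = c *\<^sub>C g x y" for c x y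
      by (simp add: lm l cscale_mult_left)
    have s2: "g x (c *\<^sub>C y) = cnj c *\<^sub>C g x y" for c x y
      by (metis s1 st kstar_simps(2))
    have z1: "g 0 y = 0" and z2: "g y 0 = 0" for y
      using s1[of 0 0 y] s2[of y 0 0] by simp_all
    have S1: "g (sum f A) y = (\<Sum>k\<in>A. g (f k) y)" for f y and A :: "'n set"
      by (induction A rule: infinite_finite_induct) (simp_all add: a1 z1)
    have S2: "g y (sum f A) = (\<Sum>k\<in>A. g y (f k))" for f y and A :: "'n set"
      by (induction A rule: infinite_finite_induct) (simp_all add: a2 z2)
    have "g v w = g (\<Sum>k\<in>UNIV. form_coeff v k *\<^sub>C exterior_d (K_alpha k))
        (\<Sum>k\<in>UNIV. form_coeff w k *\<^sub>C exterior_d (K_alpha k))"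
      by (simp flip: form_expand)
    then show ?thesis
      by (subst sum.swap) (simp add: S1 S2 s1 s2 cscale_sum_right mult.commute)
  qed
  have "h v w = h' v w" for v w
    using eq[of h v w] eq[of h' v w] h h' by simp
  then show "h = h'" by (simp add: fun_eq_iff)
qed

lemma ex1_bilinear_nabla:
  "\<exists>!nabla :: 'n::finite lie \<Rightarrow> 'n form \<Rightarrow> 'n form. complex_bilinear nabla \<and>
    (\<forall>i j. nabla (lie_basis i) (exterior_d (K_alpha j))
       = (if i = j then (1/2) *\<^sub>C exterior_d (K_alpha i) else 0))"
proof (rule ex_ex1I)
  define nabla where "nabla d w = (\<Sum>k\<in>UNIV. (1/2 * lie_coeff d k * form_coeff w k)
    *\<^sub>C (exterior_d (K_alpha k) :: 'n form))" for d w
  have "complex_bilinear nabla"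
    unfolding complex_bilinear_def
    by (auto simp: nabla_def distrib_left distrib_right cscale_add_left sum.distrib
        cscale_sum_right add_divide_distrib intro!: sum.cong)
      (simp_all add: ac_simps)
  moreover have "nabla (lie_basis i) (exterior_d (K_alpha j))
       = (if i = j then (1/2) *\<^sub>C exterior_d (K_alpha i) else 0)" for i j
  proof -
    have "nabla (lie_basis i) (exterior_d (K_alpha j))
        = (\<Sum>k\<in>UNIV. if k = i then (if i = j then (1/2) *\<^sub>C exterior_d (K_alpha i) else 0) else 0)"
      unfolding nabla_def by (rule sum.cong) auto
    then show ?thesis by simp
  qed
  ultimately show "\<exists>nabla :: 'n lie \<Rightarrow> 'n form \<Rightarrow> 'n form. complex_bilinear nabla \<and>
    (\<forall>i j. nabla (lie_basis i) (exterior_d (K_alpha j))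
       = (if i = j then (1/2) *\<^sub>C exterior_d (K_alpha i) else 0))" by blast
next
  fix f g :: "'n lie \<Rightarrow> 'n form \<Rightarrow> 'n form"
  assume f: "complex_bilinear f \<and> (\<forall>i j. f (lie_basis i) (exterior_d (K_alpha j))
       = (if i = j then (1/2) *\<^sub>C exterior_d (K_alpha i) else 0))"
    and g: "complex_bilinear g \<and> (\<forall>i j. g (lie_basis i) (exterior_d (K_alpha j))
       = (if i = j then (1/2) *\<^sub>C exterior_d (K_alpha i) else 0))"
  have eq: "u d w = (\<Sum>k\<in>UNIV. \<Sum>l\<in>UNIV. (lie_coeff d k * form_coeff w l)
      *\<^sub>C u (lie_basis k) (exterior_d (K_alpha l)))"
    if "complex_bilinear u" for u :: "'n lie \<Rightarrow> 'n form \<Rightarrow> 'n form" and d w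
  proof -
    from that have a1: "u (x + y) z = u x z + u y z" and a2: "u x (z + z') = u x z + u x z'"
      and s1: "u (c *\<^sub>C x) z = c *\<^sub>C u x z" and s2: "u x (c *\<^sub>C z) = c *\<^sub>C u x z" for x y z z' c
      by (auto simp: complex_bilinear_def)
    have z1: "u 0 z = 0" and z2: "u x 0 = 0" for x z
      using s1[of 0 0 z] s2[of x 0 0] by simp_all
    have S1: "u (sum p A) y = (\<Sum>k\<in>A. u (p k) y)" for p y and A :: "'n set"
      by (induction A rule: infinite_finite_induct) (simp_all add: a1 z1)
    have S2: "u y (sum p A) = (\<Sum>k\<in>A. u y (p k))" for p y and A :: "'n set"
      by (induction A rule: infinite_finite_induct) (simp_all add: a2 z2)
    have "u d w = u (\<Sum>k\<in>UNIV. lie_coeff d k *\<^sub>C lie_basis k)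
        (\<Sum>k\<in>UNIV. form_coeff w k *\<^sub>C exterior_d (K_alpha k))"
      by (simp flip: form_expand lie_expand)
    then show ?thesis
      by (subst sum.swap) (simp add: S1 S2 s1 s2 cscale_sum_right mult.commute)
  qed
  have "f d w = g d w" for d w
    using eq[of f d w] eq[of g d w] f g by simp
  then show "f = g" by (simp add: fun_eq_iff)
qed

lemma star_bimodule_connection_imp_bimodule_connection:
  assumes "star_bimodule_connection nabla"
  shows "bimodule_connection nabla"
proof -
  have L: "left_connection nabla" and S: "\<And>d w. form_star (nabla d w) = nabla (lie_star d) (form_star w)"
    using assms by (auto simp: star_bimodule_connection_def)
  have dd [simp]: "lie_star (lie_star d) = d" for d :: "'a lie" by (rule lie_eqI) simp
  have ss [simp]: "form_star (form_star w) = w" for w :: "'a form" by (rule form_eqI) simp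
  have sl: "form_star (w \<cdot>\<^sub>r a) = kstar a \<cdot>\<^sub>l form_star w" for w :: "'a form" and a
    by (rule form_eqI) simp
  have sr: "form_star (a \<cdot>\<^sub>l w) = form_star w \<cdot>\<^sub>r kstar a" for w :: "'a form" and a
    by (rule form_eqI) simp
  have sp: "form_star (v + w) = form_star v + form_star w" for v w :: "'a form"
    by (rule form_eqI) simp
  have "nabla d (w \<cdot>\<^sub>r a) = nabla d w \<cdot>\<^sub>r a + w \<cdot>\<^sub>r apply_der d a" for d w a
  proof -
    have "nabla d (w \<cdot>\<^sub>r a) = form_star (form_star (nabla d (w \<cdot>\<^sub>r a)))" by simp
    also have "\<dots> = form_star (nabla (lie_star d) (kstar a \<cdot>\<^sub>l form_star w))"
      by (simp only: S sl)
    also have "\<dots> = form_star (kstar a \<cdot>\<^sub>l nabla (lie_star d) (form_star w)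
        + apply_der (lie_star d) (kstar a) \<cdot>\<^sub>l form_star w)"
      using L by (simp add: left_connection_def)
    also have "\<dots> = nabla d w \<cdot>\<^sub>r a + w \<cdot>\<^sub>r apply_der d a"
      by (simp add: sp sr S)
    finally show ?thesis .
  qed
  with L show ?thesis
    by (simp add: bimodule_connection_def right_connection_def left_connection_def)
qed

end

theory Submission
  imports Defs
begin

text \<open>
  Everything is diagonal.  Write \<open>d = (\<Sum>k. d\<^sub>k \<partial>\<^sub>k)\<close> for a derivation and \<open>w = (\<Sum>k. w\<^sub>k d\<alpha>\<^sub>k)\<close> for a
  one-form.  Every derivation in the Lie algebra acts on the span of the \<open>\<alpha>\<^sub>k\<close> by the diagonal
  matrix of its coefficients, pairing \<open>w\<close> with \<open>d\<close> gives \<open>(\<Sum>k. w\<^sub>k d\<^sub>k \<alpha>\<^sub>k)\<close>, both involutions conjugate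
  the coefficients, and \<open>\<nabla>\<close> multiplies \<open>w\<^sub>k\<close> by \<open>d\<^sub>k / 2\<close>.  The claims then become
  identities between coefficients:

  The left Leibniz rule holds because \<open>K\<close> acts on one-forms from the left by scalars, through the
  character with \<open>1, e \<mapsto> 1\<close> and \<open>\<alpha>\<^sub>k \<mapsto> 0\<close> (\<open>lmult_eq_cscale\<close>).  This character kills all
  \<open>d(a)\<close>, so the term \<open>d(a) w\<close> vanishes, and what remains is the linearity of \<open>\<nabla>\<^sub>d\<close>.
  Compatibility with the involutions is the fact that \<open>1/2\<close> is real.

  For the torsion, \<open>(\<nabla>\<^sub>d w)(d')\<close> and \<open>d(w(d'))\<close> have coefficients \<open>w\<^sub>k d\<^sub>k d'\<^sub>k\<close> up to the factor
  \<open>1/2\<close>, symmetric in \<open>d\<close> and \<open>d'\<close>, and the Lie algebra is abelian; hence the torsion is zero,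
  for any value of the factor.  The value \<open>1/2\<close> is what compatibility with \<open>h\<close> needs: \<open>d\<close> multiplies
  the coefficient of \<open>\<alpha>\<^sub>k\<close> in \<open>h(v, w)\<close> by \<open>d\<^sub>k\<close>, and each of the two terms on the right contributes
  half of that; in the second term the conjugation of \<open>d\<^sub>k\<close> in \<open>d\<^sup>*\<close> cancels the one in the second
  argument of \<open>h\<close>.
\<close>

lemma apply_form_coeff:
  "apply_form w d = (\<Sum>k\<in>UNIV. (form_coeff w k * lie_coeff d k) *\<^sub>C K_alpha k)"
  by (subst form_expand[of w]) (simp add: apply_der_alpha)

lemma apply_der_sum_alpha:
  "apply_der d (\<Sum>k\<in>UNIV. c k *\<^sub>C K_alpha k) = (\<Sum>k\<in>UNIV. (lie_coeff d k * c k) *\<^sub>C K_alpha k)"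
  by (simp add: apply_der_coeff[of d] cscale_sum_right)

lemma lie_coeff_star: "lie_coeff (lie_star d) k = cnj (lie_coeff d k)"
  by (simp add: lie_coeff_def[of "lie_star d"] apply_der_alpha[of d])

lemma lie_coeff_zero: "lie_coeff 0 k = 0"
  by (simp add: lie_coeff_def zero_lie.rep_eq)

lemma form_coeff_star: "form_coeff (form_star w) k = cnj (form_coeff w k)"
  by (simp add: form_coeff_def[of "form_star w"] apply_form_coeff[of w] lie_coeff_star)

lemma form_eqI_coeff: "(\<And>k. form_coeff v k = form_coeff w k) \<Longrightarrow> v = w"
  by (subst form_expand[of v], subst form_expand[of w]) simp

lemma lie_bracket_eq_zero: "lie_bracket d d' = 0"
proof (rule lie_eqI)
  fix x
  have "apply_der d (apply_der d' x) = apply_der d' (apply_der d x)"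
    unfolding apply_der_coeff[of d] apply_der_coeff[of d']
    by (simp add: cscale_sum_right) (subst sum.swap, simp add: mult.commute partial_tilde_commute)
  then show "apply_der (lie_bracket d d') x = apply_der 0 x"
    by (simp add: lie_bracket.rep_eq zero_lie.rep_eq)
qed

lemma lmult_eq_cscale: "a \<cdot>\<^sub>l w = (co_1 (to_coords a) + co_e (to_coords a)) *\<^sub>C w"
  by (rule form_eqI_coeff) (simp add: form_coeff_lmult)

lemma apply_der_lmult_eq_zero: "apply_der d a \<cdot>\<^sub>l w = 0"
  by (simp add: lmult_eq_cscale apply_der_coeff[of d a] partial_tilde_eq)

lemma complex_bilinear_sum:
  fixes c :: "'i \<Rightarrow> complex" and e :: "'j \<Rightarrow> complex"
  assumes "complex_bilinear f"
  shows "f (\<Sum>i\<in>A. c i *\<^sub>C x i) (\<Sum>j\<in>B. e j *\<^sub>C y j)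
    = (\<Sum>i\<in>A. \<Sum>j\<in>B. (c i * e j) *\<^sub>C f (x i) (y j))"
proof -
  have add: "f (u + u') z = f u z + f u' z" "f u (z + z') = f u z + f u z'"
    and scale: "f (a *\<^sub>C u) z = a *\<^sub>C f u z" "f u (a *\<^sub>C z) = a *\<^sub>C f u z" for a u u' z z'
    using assms by (auto simp: complex_bilinear_def)
  have zero: "f 0 z = 0" "f u 0 = 0" for u z
    using scale(1)[of 0 0 z] scale(2)[of u 0 0] by simp_all
  have "f (\<Sum>i\<in>A. c i *\<^sub>C x i) z = (\<Sum>i\<in>A. c i *\<^sub>C f (x i) z)" for z
    by (induction A rule: infinite_finite_induct) (simp_all add: add scale zero)
  moreover have "f u (\<Sum>j\<in>B. e j *\<^sub>C y j) = (\<Sum>j\<in>B. e j *\<^sub>C f u (y j))" for u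
    by (induction B rule: infinite_finite_induct) (simp_all add: add scale zero)
  ultimately show ?thesis
    by (subst sum.swap) (simp add: cscale_sum_right mult.commute)
qed

lemma form_coeff_nabla:
  fixes nabla :: "'n::finite lie \<Rightarrow> 'n form \<Rightarrow> 'n form"
  assumes "complex_bilinear nabla"
    and "\<And>i j. nabla (lie_basis i) (exterior_d (K_alpha j))
                 = (if i = j then (1/2) *\<^sub>C exterior_d (K_alpha i) else 0)"
  shows "form_coeff (nabla d w) k = lie_coeff d k * form_coeff w k / 2"
proof -
  have "nabla d w = (\<Sum>i\<in>UNIV. \<Sum>j\<in>UNIV. (lie_coeff d i * form_coeff w j)
      *\<^sub>C nabla (lie_basis i) (exterior_d (K_alpha j)))"
    by (subst lie_expand[of d], subst form_expand[of w]) (rule complex_bilinear_sum[OF assms(1)])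
  then show ?thesis by (simp add: assms(2) flip: sum_divide_distrib)
qed

text \<open>
  A hermitian form is conjugate-linear in its second argument, so it becomes bilinear after a twist by
  the involution of one-forms; the twist does not affect the values on the forms \<open>d\<alpha>\<^sub>k\<close>, which are
  self-adjoint.
\<close>

lemma hermitian_form_coeff:
  fixes h :: "'n::finite form \<Rightarrow> 'n form \<Rightarrow> 'n kalg"
  assumes "left_hermitian_form h"
    and "\<And>i j. h (exterior_d (K_alpha i)) (exterior_d (K_alpha j))
                 = (if i = j then complex_of_real (lam i) *\<^sub>C K_alpha i else 0)"
  shows "h v w
    = (\<Sum>k\<in>UNIV. (form_coeff v k * cnj (form_coeff w k) * complex_of_real (lam k)) *\<^sub>C K_alpha k)"
proof -
  have add: "h (x + y) z = h x z + h y z" "h z (x + y) = h z x + h z y"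
    and left: "h (a \<cdot>\<^sub>l x) y = a * h x y" and star: "kstar (h x y) = h y x" for a x y z
    using assms(1) by (auto simp: left_hermitian_form_def)
  have scalar: "c *\<^sub>C x = (c *\<^sub>C 1) \<cdot>\<^sub>l x" for c and x :: "'n form"
    by (simp add: lmult_eq_cscale)
  have scale_left: "h (c *\<^sub>C x) y = c *\<^sub>C h x y" for c x y
    by (simp add: scalar left cscale_mult_left)
  have scale_right: "h x (c *\<^sub>C y) = cnj c *\<^sub>C h x y" for c x y
    by (metis scale_left star kstar_simps(2))
  have star_add: "form_star (x + y) = form_star x + form_star y"
    and star_scale: "form_star (c *\<^sub>C x) = cnj c *\<^sub>C form_star x"
    and star_star: "form_star (form_star x) = x" for c and x y :: "'n form"
    by (rule form_eqI_coeff, simp add: form_coeff_star)+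
  have star_basis: "form_star (exterior_d (K_alpha k)) = exterior_d (K_alpha k)" for k :: 'n
    by (rule form_eqI_coeff) (simp add: form_coeff_star)
  have bilinear: "complex_bilinear (\<lambda>x y. h x (form_star y))"
    by (simp add: complex_bilinear_def add star_add star_scale scale_left scale_right)
  have "h v w = h (\<Sum>i\<in>UNIV. form_coeff v i *\<^sub>C exterior_d (K_alpha i))
      (form_star (\<Sum>j\<in>UNIV. form_coeff (form_star w) j *\<^sub>C exterior_d (K_alpha j)))"
    by (simp add: star_star flip: form_expand)
  also have "\<dots> = (\<Sum>i\<in>UNIV. \<Sum>j\<in>UNIV. (form_coeff v i * cnj (form_coeff w j))
      *\<^sub>C h (exterior_d (K_alpha i)) (exterior_d (K_alpha j)))"
    by (simp add: complex_bilinear_sum[OF bilinear] star_basis form_coeff_star)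
  finally show ?thesis by (simp add: assms(2))
qed

theorem mainTheorem3:
  fixes lam :: "'n::finite \<Rightarrow> real"
    and h :: "'n form \<Rightarrow> 'n form \<Rightarrow> 'n kalg"
    and nabla :: "'n lie \<Rightarrow> 'n form \<Rightarrow> 'n form"
  assumes "left_hermitian_form h"
    and "\<And>i j. h (exterior_d (K_alpha i)) (exterior_d (K_alpha j))
                 = (if i = j then complex_of_real (lam i) *\<^sub>C K_alpha i else 0)"
    and "complex_bilinear nabla"
    and "\<And>i j. nabla (lie_basis i) (exterior_d (K_alpha j))
                 = (if i = j then (1/2) *\<^sub>C exterior_d (K_alpha i) else 0)"
  shows "star_bimodule_levi_civita nabla h"
proof -
  note nabla = form_coeff_nabla[OF assms(3,4)]
  note h = hermitian_form_coeff[OF assms(1,2)]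
  have "left_connection nabla"
    using assms(3)
    by (simp add: left_connection_def complex_bilinear_def lmult_eq_cscale[of _ "nabla _ _"]
        apply_der_lmult_eq_zero) (simp add: lmult_eq_cscale)
  moreover have "form_star (nabla d w) = nabla (lie_star d) (form_star w)" for d w
    by (rule form_eqI_coeff) (simp add: form_coeff_star lie_coeff_star nabla)
  ultimately have "star_bimodule_connection nabla"
    by (simp add: star_bimodule_connection_def)
  moreover have "torsion_free nabla"
    unfolding torsion_free_def exterior_d2_def
    by (simp add: lie_bracket_eq_zero lie_coeff_zero apply_form_coeff apply_der_sum_alpha
        nabla ac_simps)
  moreover have "apply_der d (h v w) = h (nabla d v) w + h v (nabla (lie_star d) w)" for d v w
    unfolding h apply_der_sum_alpha nabla lie_coeff_star sum.distrib[symmetric]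
      cscale_add_left[symmetric]
    by (simp add: field_simps)
  then have "compatible nabla h"
    by (simp add: compatible_def)
  ultimately show ?thesis
    by (simp add: star_bimodule_levi_civita_def)
qed

end
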